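(* Let $L>0$, let $f:\mathbb{R}^n\to\mathbb{R}$ be a convex $L$-smooth function with a minimizer $x_\star$, let $k\ge 0$ be an integer and let $N=2^{k+1}-2$. For any $x_0\in\mathbb{R}^n$, let $x_1,\dots,x_N$ be generated by gradient descent $x_{i+1}=x_i-\frac{h_i}{L}\nabla f(x_i)$, $i=0,\dots,N-1$, with stepsizes $h=(h_0,\dots,h_{N-1})=[\mathfrak{h}^{(k)}_{\mathrm{right}},\mathfrak{h}^{(k)}_{\mathrm{left}}]$ (concatenation). Then $$\|\nabla f(x_N)\|\le \frac{L\|x_0-x_\star\|}{r_k}\simeq \frac{\varrho}{(\varrho-1)(1+\varrho^{-1/2})}\cdot\frac{L\|x_0-x_\star\|}{N^{\log_2\varrho}},$$ where $\simeq$ denotes equality up to lower-order terms as $k\to\infty$, i.e. with $N=2^{k+1}-2$, $\lim_{k\to\infty} r_k/N^{\log_2\varrho}=(\varrho-1)(1+\varrho^{-1/2})/\varrho$.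
   Context: $L$-smooth means differentiable with $L$-Lipschitz gradient (Euclidean norm). Let $\varrho=1+\sqrt2$ and $\beta_k=1+\varrho^{k-1}$ for $k\ge0$. All finite sequences are indexed starting from $0$, and $[\cdot,\cdot,\cdot]$ denotes concatenation. The silver stepsize schedules $\pi^{(k)}\in\mathbb{R}^{2^k-1}$, $k\ge1$, are defined by $\pi^{(1)}=[\sqrt2]$ and $\pi^{(k+1)}=[\pi^{(k)},\beta_k,\pi^{(k)}]$. The sequences $\mathfrak{h}^{(k)}_{\mathrm{right}}\in\mathbb{R}^{2^k-1}$, $k\ge1$, are defined by $\mathfrak{h}^{(1)}_{\mathrm{right}}=[3/2]$ and $\mathfrak{h}^{(k+1)}_{\mathrm{right}}=[\pi^{(k)},\alpha_k,\mathfrak{h}^{(k)}_{\mathrm{right}}]$, where $\alpha_k$ is the unique real number with $\alpha_k\ge1$ such that $$1+2\sum_{i=0}^{2^{k+1}-2}(\mathfrak{h}^{(k+1)}_{\mathrm{right}})_i=\prod_{i=0}^{2^{k+1}-2}\big((\mathfrak{h}^{(k+1)}_{\mathrm{right}})_i-1\big)^{-2}.$$ The sequence $\mathfrak{h}^{(k)}_{\mathrm{left}}$ is $\mathfrak{h}^{(k)}_{\mathrm{right}}$ in reverse order, i.e. $\mathfrak{h}^{(1)}_{\mathrm{left}}=[3/2]$ and $\mathfrak{h}^{(k+1)}_{\mathrm{left}}=[\mathfrak{h}^{(k)}_{\mathrm{left}},\alpha_k,\pi^{(k)}]$. Define $r_k=1+2\sum_{i=0}^{2^k-2}(\mathfrak{h}^{(k)}_{\mathrm{right}})_i=\prod_{i=0}^{2^k-2}\big((\mathfrak{h}^{(k)}_{\mathrm{right}})_i-1\big)^{-2}$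 (for instance $r_1=4$). For $k=0$ the sequences $\mathfrak{h}^{(0)}_{\mathrm{left}}$ and $\mathfrak{h}^{(0)}_{\mathrm{right}}$ are empty and $r_0=1$. *)

theory Defs
  imports "HOL-Analysis.Analysis"
begin

definition grad :: "('a::real_inner \<Rightarrow> real) \<Rightarrow> 'a \<Rightarrow> 'a" where
  "grad f x = (THE g. GDERIV f x :> g)"

lemma grad_eqI: "GDERIV f x :> g \<Longrightarrow> grad f x = g"
  unfolding grad_def
proof (rule the_equality)
  fix g' assume "GDERIV f x :> g" "GDERIV f x :> g'"
  then have "(\<lambda>h. h \<bullet> g) = (\<lambda>h. h \<bullet> g')"
    unfolding gderiv_def by (rule has_derivative_unique)
  then have "h \<bullet> (g' - g) = 0" for h
    by (simp add: inner_diff_right fun_eq_iff)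
  from this[of "g' - g"] show "g' = g" by simp
qed

definition L_smooth :: "real \<Rightarrow> ('a::euclidean_space \<Rightarrow> real) \<Rightarrow> bool" where
  "L_smooth L f \<longleftrightarrow> f differentiable_on UNIV \<and> L-lipschitz_on UNIV (grad f)"

lemma L_smooth_GDERIV:
  fixes f :: "'a::euclidean_space \<Rightarrow> real"
  assumes "L_smooth L f"
  shows "GDERIV f x :> grad f x"
proof -
  from assms obtain D where D: "(f has_derivative D) (at x)"
    unfolding L_smooth_def differentiable_on_def differentiable_def by auto
  interpret bounded_linear D by (rule has_derivative_bounded_linear[OF D])
  define g where "g = (\<Sum>b\<in>Basis. D b *\<^sub>R b)"
  have "D h = h \<bullet> g" for h
  proof -
    have "D h = D (\<Sum>b\<in>Basis. (h \<bullet> b) *\<^sub>R b)" by (simp add: euclidean_representation)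
    also have "\<dots> = (\<Sum>b\<in>Basis. (h \<bullet> b) * D b)" by (simp add: sum scaleR)
    also have "\<dots> = h \<bullet> g" by (simp add: g_def inner_sum_right mult.commute)
    finally show ?thesis .
  qed
  then have "GDERIV f x :> g" using D unfolding gderiv_def by (metis ext)
  with grad_eqI[OF this] show ?thesis by simp
qed

definition rho :: real where
  "rho = 1 + sqrt 2"

definition beta :: "nat \<Rightarrow> real" where
  "beta k = 1 + rho powi (int k - 1)"

(* The schedules are indexed from 1; the value at 0 is a filler, never used in h_right.
   Since beta 0 = sqrt 2, taking it empty is consistent with the recursion. *)
fun silver :: "nat \<Rightarrow> real list" where
  "silver 0 = []"
| "silver (Suc 0) = [sqrt 2]"
| "silver (Suc (Suc k)) = silver (Suc k) @ [beta (Suc k)] @ silver (Suc k)"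

definition balanced :: "real list \<Rightarrow> bool" where
  "balanced hs \<longleftrightarrow> 1 + 2 * (\<Sum>h\<leftarrow>hs. h) = (\<Prod>h\<leftarrow>hs. (h - 1) powi (-2))"

(* The convention 0 powi (-2) = 0 adds no spurious solution a = 1, since then the
   left-hand side of balanced is positive; see ex1_alpha below. *)
fun h_right :: "nat \<Rightarrow> real list" where
  "h_right 0 = []"
| "h_right (Suc 0) = [3/2]"
| "h_right (Suc (Suc k)) =
     silver (Suc k)
     @ [THE a. 1 \<le> a \<and> balanced (silver (Suc k) @ [a] @ h_right (Suc k))]
     @ h_right (Suc k)"

definition h_left :: "nat \<Rightarrow> real list" where
  "h_left k = rev (h_right k)"

definition r :: "nat \<Rightarrow> real" where
  "r k = 1 + 2 * (\<Sum>h\<leftarrow>h_right k. h)"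

lemma length_silver: "length (silver k) = 2 ^ k - 1"
proof (induction k rule: silver.induct)
  case (3 k)
  have "(1::nat) \<le> 2 ^ Suc k" by (rule one_le_power) simp
  with 3 show ?case by simp
qed auto

lemma length_h_right: "length (h_right k) = 2 ^ k - 1"
proof (induction k rule: h_right.induct)
  case (3 k)
  have "(1::nat) \<le> 2 ^ Suc k" by (rule one_le_power) simp
  with 3 show ?case by (simp add: length_silver)
qed auto

lemma silver_gt_1: "h \<in> set (silver k) \<Longrightarrow> 1 < h"
proof (induction k rule: silver.induct)
  case (3 k)
  have "0 < rho" by (simp add: rho_def add_pos_nonneg)
  then have "1 < beta (Suc k)" unfolding beta_def by (simp add: zero_less_power_int)
  with 3 show ?case by auto
qed auto

lemma prod_list_powi_pos:
  fixes hs :: "real list"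
  assumes "\<And>h. h \<in> set hs \<Longrightarrow> 1 < h"
  shows "0 < (\<Prod>h\<leftarrow>hs. (h - 1) powi (-2))"
  using assms by (induction hs) (auto intro!: mult_pos_pos zero_less_power_int)

lemma ex1_balanced:
  assumes xs: "\<And>h. h \<in> set xs \<Longrightarrow> 1 < h" and ys: "\<And>h. h \<in> set ys \<Longrightarrow> 1 < h"
  shows "\<exists>!a. 1 \<le> a \<and> balanced (xs @ [a] @ ys)"
proof -
  define S where "S = 1 + 2 * (\<Sum>h\<leftarrow>xs @ ys. h)"
  define P where "P = (\<Prod>h\<leftarrow>xs @ ys. (h - 1) powi (-2))"
  have "0 \<le> (\<Sum>h\<leftarrow>xs @ ys. h)"
    using xs ys by (intro sum_list_nonneg) force
  then have S: "1 \<le> S" by (simp add: S_def)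
  have P: "0 < P" unfolding P_def using xs ys by (intro prod_list_powi_pos) auto
  have bal: "balanced (xs @ [a] @ ys) \<longleftrightarrow> S + 2 * a = P * (a - 1) powi (-2)" for a
    by (simp add: balanced_def S_def P_def algebra_simps)
  define F where "F a = (S + 2 * a) * (a - 1)\<^sup>2" for a :: real
  have iff: "1 \<le> a \<and> balanced (xs @ [a] @ ys) \<longleftrightarrow> 1 \<le> a \<and> F a = P" for a
  proof (cases "a = 1")
    case True
    then show ?thesis unfolding bal F_def using S P by simp
  next
    case False
    then have eq: "P * (a - 1) powi (-2) = P / (a - 1)\<^sup>2"
      by (simp add: power_int_minus divide_inverse)
    show ?thesis unfolding bal F_def eq using False by (simp add: eq_divide_eq)
  qed
  have mono: "F a < F b" if "1 \<le> a" "a < b" for a b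
  proof -
    have "(a - 1)\<^sup>2 < (b - 1)\<^sup>2" using that by (intro power_strict_mono) auto
    then show ?thesis unfolding F_def using that S by (intro mult_strict_mono) auto
  qed
  have "\<exists>a\<ge>1. a \<le> 2 + P \<and> F a = P"
  proof (rule IVT')
    show "F 1 \<le> P" using P by (simp add: F_def)
    have "P \<le> 1 * (1 + P)\<^sup>2" using P by (simp add: power2_eq_square algebra_simps)
    also have "\<dots> \<le> (S + 2 * (2 + P)) * (1 + P)\<^sup>2"
      using S P by (intro mult_right_mono) auto
    finally show "P \<le> F (2 + P)" by (simp add: F_def)
    show "continuous_on {1..2 + P} F" unfolding F_def by (intro continuous_intros)
  qed (use P in auto)
  then obtain a where "1 \<le> a" "F a = P" by blast
  moreover have "b = a" if "1 \<le> b" "F b = P" for b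
    using mono[of a b] mono[of b a] that calculation by (cases a b rule: linorder_cases) auto
  ultimately show ?thesis unfolding iff by blast
qed

lemma balanced_gt_1:
  assumes "\<And>h. h \<in> set xs \<Longrightarrow> 1 < h" "\<And>h. h \<in> set ys \<Longrightarrow> 1 < h"
    and "1 \<le> a" "balanced (xs @ [a] @ ys)"
  shows "1 < a"
proof -
  have "0 \<le> (\<Sum>h\<leftarrow>xs @ ys. h)"
    using assms(1,2) by (intro sum_list_nonneg) force
  then have "a \<noteq> 1" using assms(4) by (auto simp: balanced_def)
  with assms(3) show ?thesis by simp
qed

lemma h_right_gt_1: "h \<in> set (h_right k) \<Longrightarrow> 1 < h"
proof (induction k arbitrary: h rule: h_right.induct)
  case (3 k)
  define a where
    "a = (THE a. 1 \<le> a \<and> balanced (silver (Suc k) @ [a] @ h_right (Suc k)))"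
  have IH: "1 < h" if "h \<in> set (h_right (Suc k))" for h
    using that by (rule 3(1))
  have "1 \<le> a \<and> balanced (silver (Suc k) @ [a] @ h_right (Suc k))"
    unfolding a_def by (rule theI'[OF ex1_balanced[OF silver_gt_1 IH]])
  then have "1 < a"
    by (elim conjE) (rule balanced_gt_1[OF silver_gt_1 IH])
  moreover have "h \<in> set (silver (Suc k)) \<or> h = a \<or> h \<in> set (h_right (Suc k))"
    using 3(3) unfolding h_right.simps a_def[symmetric] by (simp, blast)
  ultimately show ?case by (elim disjE) (simp_all only: silver_gt_1 IH)
qed auto

lemma ex1_alpha: "\<exists>!a. 1 \<le> a \<and> balanced (silver k @ [a] @ h_right k)"
  using silver_gt_1 h_right_gt_1 by (rule ex1_balanced)

lemma balanced_h_right: "balanced (h_right k)"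
proof (cases k rule: h_right.cases)
  case (3 j)
  then show ?thesis using theI'[OF ex1_alpha[of "Suc j"]] by simp
qed (simp_all add: balanced_def power_int_minus power2_eq_square)

lemma r_eq_prod: "r k = (\<Prod>h\<leftarrow>h_right k. (h - 1) powi (-2))"
  using balanced_h_right[of k] by (simp add: balanced_def r_def)

end

theory Submission imports Defs begin

text \<open>
  The schedule halves the work at its midpoint. With \<open>n = 2 ^ k - 1\<close>, the first half
  \<^term>\<open>h_right k\<close> makes the function value small,
  \<open>f x\<^sub>n - f xstar \<le> L * norm (x\<^sub>0 - xstar)\<^sup>2 / (2 * r k)\<close>, and the second half
  \<^term>\<open>h_left k\<close> turns a small function value into a small gradient,
  \<open>norm (grad f x\<^sub>N)\<^sup>2 \<le> 2 * L * (f x\<^sub>n - f xstar) / r k\<close>. Multiplying the two gives the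
  theorem (\<open>norm_gradient_bound\<close>).

  After dividing \<open>f\<close> and its gradient by \<open>L\<close>, the only property of \<open>f\<close> that matters is the
  interpolation inequality of convex 1-smooth functions, which is the assumption of the locale
  \<open>interpolable\<close>. Each kind of schedule carries a bound that survives composition:
  \<open>silver_bound\<close> for the silver schedules, and \<open>right_bound\<close> and \<open>left_bound\<close> for the two
  halves above. The first two hold against an arbitrary reference point \<open>y\<close> rather than only the
  minimizer. This is what makes the induction work: when two blocks are joined by one long step,
  the bound of the later block is used again with iterates as reference points, and the sum of
  all these inequalities and a few instances of interpolation is exactly the bound for the joined
  block, every remaining term cancelling (\<open>silver_bound_glue\<close>, \<open>right_bound_glue\<close>,
  \<open>left_bound_glue\<close>).

  Write the long step that joins \<^term>\<open>silver k\<close> to \<^term>\<open>h_right k\<close> as \<open>1 + z\<close>, and let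
  \<open>R = rho ^ k\<close>, which is one more than the sum of the silver schedule and the square root of
  its product \<open>\<Prod>(h - 1) powi (-2)\<close>. The balance condition is then a cubic in \<open>z\<close> with the factor
  \<open>R + z\<close>; removing it leaves \<open>r k * (R - z) = 2 * z\<^sup>2\<close> (\<open>r_excess\<close>), which is exactly what makes
  the terms cancel in the last two composition steps.

  The same quadratic gives the asymptotics. The ratios \<open>u = R / z\<close> determine
  \<open>r k = 2 * rho ^ k / (u\<^sup>2 - u)\<close>, and they follow the recursion
  \<open>u'\<^sup>2 - u' = rho * (1 - 1 / u)\<close>, a contraction towards its fixed point \<open>sqrt rho\<close>.
\<close>

section \<open>Gradient descent along a list of stepsizes\<close>

fun gd :: "('a::real_vector \<Rightarrow> 'a) \<Rightarrow> 'a \<Rightarrow> real list \<Rightarrow> 'a" where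
  "gd \<gamma> x [] = x"
| "gd \<gamma> x (h # hs) = gd \<gamma> (x - h *\<^sub>R \<gamma> x) hs"

lemma gd_append: "gd \<gamma> x (hs @ hs') = gd \<gamma> (gd \<gamma> x hs) hs'"
  by (induction hs arbitrary: x) auto

lemma gd_eqI:
  assumes "\<And>i. i < length hs \<Longrightarrow> x (Suc i) = x i - (hs ! i) *\<^sub>R \<gamma> (x i)"
  shows "x (length hs) = gd \<gamma> (x 0) hs"
  using assms
proof (induction hs arbitrary: x)
  case (Cons h hs)
  have "x (Suc (length hs)) = gd \<gamma> (x (Suc 0)) hs"
    using Cons.prems[of "Suc _"] by (intro Cons.IH[of "\<lambda>i. x (Suc i)"]) auto
  then show ?case using Cons.prems[of 0] by simp
qed simp

section \<open>Arithmetic of the schedules\<close>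

lemma rho_gt_1: "1 < rho" by (simp add: rho_def)

lemma rho_square: "rho\<^sup>2 = 2 * rho + 1"
  by (simp add: rho_def power2_eq_square algebra_simps)

lemma beta_eq: "beta k = 1 + rho ^ k / rho"
  using rho_gt_1 by (simp add: beta_def power_int_diff)

text \<open>The recursion extends to the empty schedule at index 0, because \<open>beta 0 = sqrt 2\<close>; all
  inductions below can therefore start from no steps at all.\<close>

lemma silver_Suc: "silver (Suc k) = silver k @ [beta k] @ silver k"
proof (cases k)
  case 0
  have "1 + 1 / rho = sqrt 2"
    using rho_gt_1 by (simp add: field_simps) (simp add: rho_def algebra_simps)
  with 0 show ?thesis by (simp add: beta_eq)
qed simp

lemma rev_silver: "rev (silver k) = silver k"
  by (induction k) (simp_all add: silver_Suc)

lemma sum_silver: "(\<Sum>h\<leftarrow>silver k. h) = rho ^ k - 1"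
proof (induction k)
  case (Suc k)
  have "rho ^ Suc k = rho ^ k * (rho\<^sup>2 / rho)" using rho_gt_1 by (simp add: power2_eq_square)
  also have "\<dots> = rho ^ k * (2 + 1 / rho)"
    unfolding rho_square using rho_gt_1 by (simp add: field_simps)
  finally show ?case
    using Suc unfolding silver_Suc by (simp add: beta_eq algebra_simps)
qed simp

lemma prod_silver: "(\<Prod>h\<leftarrow>silver k. (h - 1) powi (-2)) = (rho ^ k)\<^sup>2"
proof (induction k)
  case (Suc k)
  have "(rho ^ k / rho) powi (-2) = rho\<^sup>2 / (rho ^ k)\<^sup>2"
    by (simp add: power_int_minus power_divide)
  then show ?case
    using Suc rho_gt_1 unfolding silver_Suc
    by (simp add: beta_eq power_mult_distrib power2_eq_square)
qed simp

text \<open>The long step of the right schedule exceeds 1 by \<open>excess k\<close>. It is read off from its position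
  in the list; this also covers \<open>k = 0\<close>, where the step is \<open>3 / 2\<close>.\<close>

definition excess :: "nat \<Rightarrow> real" where
  "excess k = h_right (Suc k) ! (2 ^ k - 1) - 1"

lemma h_right_Suc: "h_right (Suc k) = silver k @ [1 + excess k] @ h_right k"
proof -
  have "\<exists>a. h_right (Suc k) = silver k @ [a] @ h_right k"
  proof (cases k)
    case 0
    then have "h_right (Suc k) = silver k @ [3 / 2] @ h_right k" by simp
    then show ?thesis ..
  qed simp
  then obtain a where a: "h_right (Suc k) = silver k @ [a] @ h_right k" ..
  then have "h_right (Suc k) ! (2 ^ k - 1) = a"
    by (metis append_Cons length_silver nth_append_length)
  with a show ?thesis by (simp add: excess_def)
qed

lemma excess_pos: "0 < excess k"
  using h_right_gt_1[of "1 + excess k" "Suc k"] unfolding h_right_Suc by simp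

lemma r_Suc: "r (Suc k) = r k + 2 * (rho ^ k + excess k)"
  unfolding r_def h_right_Suc using sum_silver[of k] by simp

lemma r_pos: "0 < r k"
proof (induction k)
  case (Suc k)
  then show ?case using excess_pos[of k] rho_gt_1 unfolding r_Suc by (simp add: add_pos_pos)
qed (simp add: r_def)

lemma r_Suc_prod: "r (Suc k) = (rho ^ k / excess k)\<^sup>2 * r k"
proof -
  have "r (Suc k) = (rho ^ k)\<^sup>2 * (excess k powi (-2) * r k)"
    unfolding r_eq_prod h_right_Suc using prod_silver[of k] by simp
  then show ?thesis by (simp add: power_int_minus power_mult_distrib power_inverse divide_inverse)
qed

text \<open>Comparing the sum form and the product form of \<^term>\<open>r (Suc k)\<close> gives the cubic
  \<open>z\<^sup>2 * (r k + 2 * (R + z)) = R\<^sup>2 * r k\<close>. Since \<open>R\<^sup>2 - z\<^sup>2\<close> contains the factor \<open>R + z\<close>, so does the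
  whole equation.\<close>

lemma r_excess: "r k * (rho ^ k - excess k) = 2 * (excess k)\<^sup>2"
proof -
  define R z where "R = rho ^ k" and "z = excess k"
  have pos: "0 < R" "0 < z" using rho_gt_1 excess_pos by (simp_all add: R_def z_def)
  have "r k + 2 * (R + z) = (R / z)\<^sup>2 * r k"
    using r_Suc[of k] r_Suc_prod[of k] unfolding R_def z_def by simp
  then have "z\<^sup>2 * (r k + 2 * (R + z)) = R\<^sup>2 * r k"
    using pos by (simp add: power_divide)
  then have "(r k * (R - z)) * (R + z) = (2 * z\<^sup>2) * (R + z)"
    by (simp add: power2_eq_square algebra_simps)
  then have "r k * (R - z) = 2 * z\<^sup>2" using pos by simp
  then show ?thesis by (simp add: R_def z_def)
qed

section \<open>Bounds that survive composition of schedules\<close>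

text \<open>The locale assumption is the interpolation inequality of a convex 1-smooth function with
  gradient \<open>\<gamma>\<close>.\<close>

locale interpolable =
  fixes \<phi> :: "'a::real_inner \<Rightarrow> real" and \<gamma> :: "'a \<Rightarrow> 'a"
  assumes interp: "\<gamma> y \<bullet> (x - y) + (norm (\<gamma> x - \<gamma> y))\<^sup>2 / 2 \<le> \<phi> x - \<phi> y"
begin

text \<open>
  In all three definitions \<open>u\<close> is the starting point of a schedule and \<open>v\<close> its last iterate. The
  silver bound is the sum, with the stepsizes as weights, of the interpolation inequalities from
  \<open>y\<close> to the iterates, plus an inequality between the iterates alone. At a minimizer \<open>y\<close>
  it reads
  \<open>(R - 1) * (\<phi> v - \<phi> y) + (R\<^sup>2 - R) * (norm (\<gamma> v))\<^sup>2 / 2 + (norm (v - y))\<^sup>2 / 2 \<le> (norm (u - y))\<^sup>2 / 2\<close>.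
\<close>

definition silver_bound :: "real \<Rightarrow> 'a \<Rightarrow> 'a \<Rightarrow> bool" where
  "silver_bound R u v \<longleftrightarrow>
     (\<forall>y. (R - 1) * (\<phi> v - \<phi> y + (norm (\<gamma> y))\<^sup>2 / 2)
        + (R\<^sup>2 - R) * (norm (\<gamma> v))\<^sup>2 / 2 + (norm (u - v))\<^sup>2 / 2
      \<le> (u - y + \<gamma> y) \<bullet> (u - v))"

text \<open>The vector \<open>w\<close> stands for the combination of gradients along the path, weighted by the
  multipliers of the inequalities that link the iterates to \<open>y\<close>. It is essential that the same \<open>w\<close> serves all
  reference points. For a minimizer \<open>y\<close>, completing
  the square in \<open>w\<close> yields \<open>c * (\<phi> v - \<phi> y) \<le> (norm (u - y))\<^sup>2 / 2\<close>.\<close>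

definition right_bound :: "real \<Rightarrow> 'a \<Rightarrow> 'a \<Rightarrow> bool" where
  "right_bound c u v \<longleftrightarrow>
     (\<exists>w. \<forall>y. c * (\<phi> v - \<phi> y + (norm (\<gamma> y))\<^sup>2 / 2) + (norm w)\<^sup>2 / 2
      \<le> (u - y + \<gamma> y) \<bullet> w)"

text \<open>The coefficient is \<open>c - 1\<close> instead of \<open>c\<close> because the missing \<open>(norm (\<gamma> v))\<^sup>2 / 2\<close> is
  supplied, once and at the very end, by \<open>\<phi> v - \<phi> y\<close> for a minimizer \<open>y\<close>.\<close>

definition left_bound :: "real \<Rightarrow> 'a \<Rightarrow> 'a \<Rightarrow> bool" where
  "left_bound c u v \<longleftrightarrow> (c - 1) * (norm (\<gamma> v))\<^sup>2 / 2 \<le> \<phi> u - \<phi> v"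

lemmas inner_expand = power2_norm_eq_inner inner_diff_left inner_diff_right inner_add_left
  inner_add_right inner_scaleR_left inner_scaleR_right

text \<open>
  This is the common core of the silver and the left composition: what a long step followed by a
  silver block gains in function value over the point \<open>u\<close> where the long step starts. The silver
  bound is used with both ends \<open>u\<close> and \<open>v\<close> as reference points: their quadratic terms in
  \<open>u - v\<close> have opposite signs and cancel, and adding the two interpolation inequalities
  between \<open>u\<close> and \<open>v\<close> with weights 1 and \<open>z\<close> cancels the remaining inner products.
\<close>

lemma long_step_gain:
  assumes S: "silver_bound R (u - (1 + z) *\<^sub>R \<gamma> u) v" and z: "0 \<le> z"
  shows "(2 * R\<^sup>2 - (R - z)) * (norm (\<gamma> v))\<^sup>2 / 2 - (2 * z\<^sup>2 - (R - z)) * (norm (\<gamma> u))\<^sup>2 / 2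
    \<le> (R - z) * (\<phi> u - \<phi> v)"
proof -
  define p q d where "p = \<gamma> u" and "q = \<gamma> v" and "d = u - v"
  have v: "v = u - d" by (simp add: d_def)
  note T = S[unfolded silver_bound_def, rule_format]
  have Tu: "(R - 1) * (\<phi> v - \<phi> u + (p \<bullet> p) / 2) + (R\<^sup>2 - R) * (q \<bullet> q) / 2
      + (d - (1 + z) *\<^sub>R p) \<bullet> (d - (1 + z) *\<^sub>R p) / 2 \<le> (- z *\<^sub>R p) \<bullet> (d - (1 + z) *\<^sub>R p)"
    using T[of u] unfolding p_def[symmetric] q_def[symmetric] power2_norm_eq_inner unfolding v
    by (simp add: algebra_simps)
  have Tv: "(R - 1) * ((q \<bullet> q) / 2) + (R\<^sup>2 - R) * (q \<bullet> q) / 2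
      + (d - (1 + z) *\<^sub>R p) \<bullet> (d - (1 + z) *\<^sub>R p) / 2
      \<le> (d - (1 + z) *\<^sub>R p + q) \<bullet> (d - (1 + z) *\<^sub>R p)"
    using T[of v] unfolding p_def[symmetric] q_def[symmetric] power2_norm_eq_inner unfolding v
    by (simp add: algebra_simps)
  have Q1: "q \<bullet> d + (p - q) \<bullet> (p - q) / 2 \<le> \<phi> u - \<phi> v"
    using interp[of v u] unfolding p_def q_def d_def power2_norm_eq_inner .
  have Q2: "- (p \<bullet> d) + (p - q) \<bullet> (p - q) / 2 \<le> \<phi> v - \<phi> u"
    using interp[of u v] unfolding p_def q_def d_def power2_norm_eq_inner
    by (simp add: inner_diff_right inner_diff_left inner_commute add_divide_distrib diff_divide_distrib)
  have Q2z: "z * (- (p \<bullet> d) + (p - q) \<bullet> (p - q) / 2) \<le> z * (\<phi> v - \<phi> u)"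
    using Q2 z by (rule mult_left_mono)
  show ?thesis
    using Tu Tv Q1 Q2z
    unfolding p_def[symmetric] q_def[symmetric] power2_norm_eq_inner
    by (simp add: inner_expand inner_commute power2_eq_square algebra_simps add_divide_distrib diff_divide_distrib)
qed


lemma silver_bound_refl: "silver_bound 1 u u"
  by (simp add: silver_bound_def)

lemma right_bound_refl: "right_bound 1 u u"
  unfolding right_bound_def
proof (intro exI[of _ "\<gamma> u"] allI)
  fix y show "1 * (\<phi> u - \<phi> y + (norm (\<gamma> y))\<^sup>2 / 2) + (norm (\<gamma> u))\<^sup>2 / 2 \<le> (u - y + \<gamma> y) \<bullet> \<gamma> u"
    using interp[of u y] by (simp add: inner_expand inner_commute algebra_simps add_divide_distrib diff_divide_distrib)
qed

lemma left_bound_refl: "left_bound 1 u u"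
  by (simp add: left_bound_def)

text \<open>
  The bounds of both blocks against \<open>y\<close> and the interpolation inequality from \<open>y\<close> to the midpoint
  \<open>v\<close>, weighted by the long step, add up to the right inner product. What is missing is exactly
  \<open>rho\<close> times \<open>long_step_gain\<close> for \<open>z = R / rho\<close>. Writing \<open>R = rho * z\<close> and reducing all powers
  of \<open>rho\<close> by \<open>rho\<^sup>2 = 2 * rho + 1\<close> makes this a linear combination.
\<close>

lemma silver_bound_glue:
  assumes A: "silver_bound R u v" and B: "silver_bound R (v - (1 + R / rho) *\<^sub>R \<gamma> v) w"
    and R: "0 \<le> R"
  shows "silver_bound (rho * R) u w"
  unfolding silver_bound_def
proof
  fix y
  define z where "z = R / rho"
  have rho: "0 < rho" "rho\<^sup>2 = 2 * rho + 1"
    using rho_gt_1 rho_square by simp_all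
  have z: "0 \<le> z" "R = rho * z" using R rho by (simp_all add: z_def)
  define p q g a d c where "p = \<gamma> v" and "q = \<gamma> w" and "g = \<gamma> y"
    and "a = u - v" and "d = v - w" and "c = u - y"
  have pts: "v = u - a" "w = u - a - d" "y = u - c" by (simp_all add: a_def d_def c_def)
  have R2: "R\<^sup>2 = (2 * rho + 1) * z\<^sup>2" using z rho by (simp add: power_mult_distrib)
  have R': "rho * R = (2 * rho + 1) * z" using z rho by (simp add: power2_eq_square)
  have R'2: "((2 * rho + 1) * z)\<^sup>2 = (12 * rho + 5) * z\<^sup>2"
  proof -
    have "(2 * rho + 1)\<^sup>2 = 4 * rho\<^sup>2 + 4 * rho + 1" by (simp add: power2_eq_square algebra_simps)
    then show ?thesis unfolding power_mult_distrib rho(2) by simp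
  qed
  have TA: "(R - 1) * (\<phi> v - \<phi> y + g \<bullet> g / 2) + (R\<^sup>2 - R) * (p \<bullet> p) / 2 + a \<bullet> a / 2 \<le> (c + g) \<bullet> a"
    using A[unfolded silver_bound_def, rule_format, of y]
    unfolding p_def g_def a_def c_def power2_norm_eq_inner .
  have TB: "(R - 1) * (\<phi> w - \<phi> y + g \<bullet> g / 2) + (R\<^sup>2 - R) * (q \<bullet> q) / 2
      + (d - (1 + z) *\<^sub>R p) \<bullet> (d - (1 + z) *\<^sub>R p) / 2
      \<le> (c - a - (1 + z) *\<^sub>R p + g) \<bullet> (d - (1 + z) *\<^sub>R p)"
    using B[unfolded silver_bound_def, rule_format, of y, folded z_def]
    unfolding p_def q_def g_def a_def d_def c_def power2_norm_eq_inner
    by (simp add: algebra_simps)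
  have "p \<bullet> (a - c) + (g - p) \<bullet> (g - p) / 2 \<le> \<phi> y - \<phi> v"
    using interp[of v y] unfolding p_def g_def a_def c_def power2_norm_eq_inner
    by (simp add: algebra_simps)
  then have Q: "(1 + z) * (p \<bullet> (a - c) + (g - p) \<bullet> (g - p) / 2) \<le> (1 + z) * (\<phi> y - \<phi> v)"
    using z by (intro mult_left_mono) auto
  have E0: "(2 * R\<^sup>2 - (R - z)) * (q \<bullet> q) / 2 - (2 * z\<^sup>2 - (R - z)) * (p \<bullet> p) / 2
    \<le> (R - z) * (\<phi> v - \<phi> w)"
    using long_step_gain[OF B[folded z_def] z(1)] unfolding p_def q_def power2_norm_eq_inner .
  have "rho * (R - z) = (rho\<^sup>2 - rho) * z" "rho * R\<^sup>2 = (2 * rho\<^sup>2 + rho) * z\<^sup>2"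
    unfolding R2 unfolding z(2) by (simp_all add: power2_eq_square algebra_simps)
  then have rr: "rho * (R - z) = (rho + 1) * z" "rho * R\<^sup>2 = (5 * rho + 2) * z\<^sup>2"
    unfolding rho(2) by simp_all
  have E: "(2 * ((5 * rho + 2) * z\<^sup>2) - (rho + 1) * z) * (q \<bullet> q) / 2
     - (2 * (rho * z\<^sup>2) - (rho + 1) * z) * (p \<bullet> p) / 2
    \<le> (rho + 1) * z * (\<phi> v - \<phi> w)"
    using mult_left_mono[OF E0, of rho] rho(1) unfolding rr[symmetric] by (simp add: algebra_simps)
  have "(rho * R - 1) * (\<phi> w - \<phi> y + g \<bullet> g / 2) + ((rho * R)\<^sup>2 - rho * R) * (q \<bullet> q) / 2
    + (a + d) \<bullet> (a + d) / 2 \<le> (c + g) \<bullet> (a + d)"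
    using TA TB Q E unfolding R' R2 unfolding R'2 unfolding z(2)
    by (simp add: inner_expand inner_commute power2_eq_square algebra_simps add_divide_distrib diff_divide_distrib)
  then show "(rho * R - 1) * (\<phi> w - \<phi> y + (norm (\<gamma> y))\<^sup>2 / 2)
        + ((rho * R)\<^sup>2 - rho * R) * (norm (\<gamma> w))\<^sup>2 / 2 + (norm (u - w))\<^sup>2 / 2
      \<le> (u - y + \<gamma> y) \<bullet> (u - w)"
    unfolding p_def q_def g_def a_def d_def c_def power2_norm_eq_inner by simp
qed

text \<open>
  With \<open>b = R / z\<close>, the vector of the joined schedule is
  \<open>(u - v) + b *\<^sub>R W + (1 + R) *\<^sub>R \<gamma> v\<close>. Its coefficients are the weights of the silver bound, of
  the later right bound and of the interpolation inequality from \<open>y\<close> to \<open>v\<close>; they are forced by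
  demanding equality for \<open>\<phi> x = (norm x)\<^sup>2 / 2\<close> with \<open>y = 0\<close> and by matching the coefficient of
  \<open>\<phi> y\<close>. These three inequalities leave over
  the terms in \<open>\<phi> v - \<phi> w\<close>, \<open>\<gamma> v\<close> and \<open>W\<close>, which
  are \<open>2 * R / c = b * (b - 1)\<close> times the later right bound with reference point \<open>v\<close>.
\<close>

lemma right_bound_glue:
  assumes A: "silver_bound R u v" and B: "right_bound c (v - (1 + z) *\<^sub>R \<gamma> v) w"
    and z: "0 < z" and c: "0 < c" and bal: "c * (R - z) = 2 * z\<^sup>2"
  shows "right_bound (c + 2 * (R + z)) u w"
proof -
  define b where "b = R / z"
  have R: "R = b * z" using z by (simp add: b_def)
  have "c * (b - 1) * z = 2 * z * z" using bal unfolding R by (simp add: algebra_simps power2_eq_square)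
  \<comment> \<open>The balance condition in terms of \<open>b\<close>; it removes \<open>c\<close> from every product with \<open>b\<close>, so that
    the final step is linear in the inner products.\<close>
  then have cb: "c * (b - 1) = 2 * z" using z by simp
  then have bc: "b * c = c + 2 * z" by (simp add: algebra_simps)
  have b: "1 \<le> b"
  proof -
    have "0 < c * (b - 1)" using cb z by simp
    then show ?thesis using c by (simp add: zero_less_mult_iff)
  qed
  from B obtain W where W: "c * (\<phi> w - \<phi> y + (norm (\<gamma> y))\<^sup>2 / 2) + (norm W)\<^sup>2 / 2
      \<le> (v - (1 + z) *\<^sub>R \<gamma> v - y + \<gamma> y) \<bullet> W" for y
    unfolding right_bound_def by blast
  show ?thesis
    unfolding right_bound_def
  proof (intro exI allI)
    fix y
    define p g a d where "p = \<gamma> v" and "g = \<gamma> y" and "a = u - v" and "d = u - y"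
    have TA: "(R - 1) * (\<phi> v - \<phi> y + g \<bullet> g / 2) + (R\<^sup>2 - R) * (p \<bullet> p) / 2 + a \<bullet> a / 2 \<le> (d + g) \<bullet> a"
      using A[unfolded silver_bound_def, rule_format, of y]
      unfolding p_def g_def a_def d_def power2_norm_eq_inner .
    have "c * (\<phi> w - \<phi> y + g \<bullet> g / 2) + W \<bullet> W / 2 \<le> (d - a - (1 + z) *\<^sub>R p + g) \<bullet> W"
      using W[of y] unfolding p_def g_def a_def d_def power2_norm_eq_inner
      by (simp add: algebra_simps)
    from mult_left_mono[OF this, of b] b
    have By: "(c + 2 * z) * (\<phi> w - \<phi> y + g \<bullet> g / 2) + b * (W \<bullet> W / 2)
        \<le> b * ((d - a - (1 + z) *\<^sub>R p + g) \<bullet> W)"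
      unfolding bc[symmetric] by (simp only: distrib_left mult.assoc)
    have "c * (\<phi> w - \<phi> v + p \<bullet> p / 2) + W \<bullet> W / 2 \<le> - z * (p \<bullet> W)"
      using W[of v] unfolding p_def power2_norm_eq_inner
      by (simp add: algebra_simps)
    from mult_left_mono[OF this, of "b * (b - 1)"] b
    have "b * (c * (b - 1)) * (\<phi> w - \<phi> v + p \<bullet> p / 2) + b * (b - 1) * (W \<bullet> W / 2)
        \<le> b * (b - 1) * (- z * (p \<bullet> W))"
      by (simp add: algebra_simps add_divide_distrib diff_divide_distrib)
    then have Bv: "b * (2 * z) * (\<phi> w - \<phi> v + p \<bullet> p / 2) + b * (b - 1) * (W \<bullet> W / 2)
        \<le> b * (b - 1) * (- z * (p \<bullet> W))"
      unfolding cb .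
    have "p \<bullet> (a - d) + (g - p) \<bullet> (g - p) / 2 \<le> \<phi> y - \<phi> v"
      using interp[of v y] unfolding p_def g_def a_def d_def power2_norm_eq_inner
      by (simp add: algebra_simps)
    then have Q: "(1 + R) * (p \<bullet> (a - d) + (g - p) \<bullet> (g - p) / 2) \<le> (1 + R) * (\<phi> y - \<phi> v)"
      using z b R by (intro mult_left_mono) auto
    have "(c + 2 * (R + z)) * (\<phi> w - \<phi> y + g \<bullet> g / 2)
        + (a + b *\<^sub>R W + (1 + R) *\<^sub>R p) \<bullet> (a + b *\<^sub>R W + (1 + R) *\<^sub>R p) / 2
      \<le> (d + g) \<bullet> (a + b *\<^sub>R W + (1 + R) *\<^sub>R p)"
      using TA By Bv Q unfolding R
      by (simp add: inner_expand inner_commute power2_eq_square algebra_simps add_divide_distrib diff_divide_distrib)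
    then show "(c + 2 * (R + z)) * (\<phi> w - \<phi> y + (norm (\<gamma> y))\<^sup>2 / 2)
        + (norm ((u - v) + b *\<^sub>R W + (1 + R) *\<^sub>R \<gamma> v))\<^sup>2 / 2
      \<le> (u - y + \<gamma> y) \<bullet> ((u - v) + b *\<^sub>R W + (1 + R) *\<^sub>R \<gamma> v)"
      unfolding p_def g_def a_def d_def power2_norm_eq_inner .
  qed
qed

text \<open>The balance condition is used twice: \<open>2 * z\<^sup>2 = c * (R - z)\<close> makes the loss at \<open>v\<close> in
  \<open>long_step_gain\<close> equal to what the earlier block has gained there, and the gain at \<open>w\<close> is
  \<open>2 * R\<^sup>2 = (c + 2 * (R + z)) * (R - z)\<close>.\<close>

lemma left_bound_glue:
  assumes A: "left_bound c u v" and B: "silver_bound R (v - (1 + z) *\<^sub>R \<gamma> v) w"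
    and z: "0 < z" and c: "0 < c" and bal: "c * (R - z) = 2 * z\<^sup>2"
  shows "left_bound (c + 2 * (R + z)) u w"
proof -
  define P Q where "P = (norm (\<gamma> v))\<^sup>2" and "Q = (norm (\<gamma> w))\<^sup>2"
  have zR: "0 < R - z"
  proof -
    have "0 < c * (R - z)" using bal z by simp
    then show ?thesis using c by (simp add: zero_less_mult_iff)
  qed
  have c': "2 * R\<^sup>2 = (c + 2 * (R + z)) * (R - z)"
    using bal by (simp add: algebra_simps power2_eq_square)
  have "(R - z) * ((c + 2 * (R + z) - 1) * Q / 2 - (c - 1) * P / 2) \<le> (R - z) * (\<phi> v - \<phi> w)"
    using long_step_gain[OF B] z unfolding P_def[symmetric] Q_def[symmetric] c' bal[symmetric]
    by (simp add: algebra_simps add_divide_distrib diff_divide_distrib)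
  then have "(c + 2 * (R + z) - 1) * Q / 2 - (c - 1) * P / 2 \<le> \<phi> v - \<phi> w"
    using zR by simp
  then show ?thesis using A unfolding left_bound_def P_def Q_def by linarith
qed


section \<open>The gradient bound for the combined schedule\<close>

lemma silver_bound_gd: "silver_bound (rho ^ k) u (gd \<gamma> u (silver k))"
proof (induction k arbitrary: u)
  case 0
  show ?case by (simp add: silver_bound_refl)
next
  case (Suc k)
  define v where "v = gd \<gamma> u (silver k)"
  have "gd \<gamma> u (silver (Suc k)) = gd \<gamma> (v - (1 + rho ^ k / rho) *\<^sub>R \<gamma> v) (silver k)"
    by (simp add: silver_Suc gd_append v_def beta_eq)
  then show ?case
    using silver_bound_glue[OF Suc.IH[of u, folded v_def] Suc.IH] rho_gt_1 by simp
qed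

lemma right_bound_gd: "right_bound (r k) u (gd \<gamma> u (h_right k))"
proof (induction k arbitrary: u)
  case 0
  show ?case by (simp add: right_bound_refl r_def)
next
  case (Suc k)
  show ?case
    unfolding h_right_Suc gd_append r_Suc
    using right_bound_glue[OF silver_bound_gd Suc.IH excess_pos r_pos r_excess] by simp
qed

lemma left_bound_gd: "left_bound (r k) u (gd \<gamma> u (h_left k))"
proof (induction k)
  case 0
  show ?case by (simp add: left_bound_refl r_def h_left_def)
next
  case (Suc k)
  have "h_left (Suc k) = h_left k @ [1 + excess k] @ silver k"
    unfolding h_left_def h_right_Suc by (simp add: rev_silver)
  then show ?case
    unfolding r_Suc
    using left_bound_glue[OF Suc.IH silver_bound_gd excess_pos r_pos r_excess] by (simp add: gd_append)
qed

theorem norm_gradient_bound: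
  assumes "\<gamma> y = 0"
  shows "norm (\<gamma> (gd \<gamma> u (h_right k @ h_left k))) \<le> norm (u - y) / r k"
proof -
  define v w where "v = gd \<gamma> u (h_right k)" and "w = gd \<gamma> v (h_left k)"
  obtain W where W: "r k * (\<phi> v - \<phi> y) + (norm W)\<^sup>2 / 2 \<le> (u - y) \<bullet> W"
    using right_bound_gd[of k u] assms unfolding right_bound_def v_def[symmetric]
    by (metis add_0_right div_0 norm_zero zero_power2)
  have "0 \<le> (norm (u - y - W))\<^sup>2" by simp
  then have "(u - y) \<bullet> W - (norm W)\<^sup>2 / 2 \<le> (norm (u - y))\<^sup>2 / 2"
    by (simp add: inner_expand inner_commute)
  with W have 1: "r k * (\<phi> v - \<phi> y) \<le> (norm (u - y))\<^sup>2 / 2" by linarith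
  have "(norm (\<gamma> w))\<^sup>2 / 2 \<le> \<phi> w - \<phi> y"
    using interp[of y w] assms by simp
  moreover have "(r k - 1) * (norm (\<gamma> w))\<^sup>2 / 2 \<le> \<phi> v - \<phi> w"
    using left_bound_gd[of k v] unfolding left_bound_def w_def .
  ultimately have "r k * ((norm (\<gamma> w))\<^sup>2 / 2) \<le> \<phi> v - \<phi> y"
    by (simp add: algebra_simps diff_divide_distrib)
  from mult_left_mono[OF this, of "r k"] 1 r_pos[of k]
  have "(r k * norm (\<gamma> w))\<^sup>2 \<le> (norm (u - y))\<^sup>2"
    by (simp add: power2_eq_square algebra_simps)
  then have "r k * norm (\<gamma> w) \<le> norm (u - y)"
    by (rule power2_le_imp_le) simp
  then show ?thesis
    using r_pos[of k] by (simp add: gd_append v_def w_def pos_le_divide_eq mult.commute)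
qed

end


section \<open>Asymptotics of the rate\<close>

definition long_ratio :: "nat \<Rightarrow> real" where
  "long_ratio k = rho ^ k / excess k"

lemma r_long_ratio: "r k = 2 / ((long_ratio k)\<^sup>2 - long_ratio k) * rho ^ k"
proof -
  define R z where "R = rho ^ k" and "z = excess k"
  have pos: "0 < R" "0 < z" using rho_gt_1 excess_pos by (simp_all add: R_def z_def)
  have eq: "r k * (R - z) = 2 * z\<^sup>2" using r_excess by (simp add: R_def z_def)
  then have ne: "R - z \<noteq> 0" using pos by auto
  have "(R / z)\<^sup>2 - R / z = R * (R - z) / z\<^sup>2"
    using pos by (simp add: field_simps power2_eq_square)
  moreover have "r k = 2 * z\<^sup>2 / (R - z)" using eq ne by (simp add: eq_divide_eq)
  ultimately show ?thesis
    using pos unfolding long_ratio_def R_def[symmetric] z_def[symmetric] by simp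
qed

lemma long_ratio_gt_1: "1 < long_ratio k"
proof -
  have "0 < r k * (rho ^ k - excess k)" unfolding r_excess using excess_pos[of k] by simp
  then have "excess k < rho ^ k" using r_pos[of k] by (simp add: zero_less_mult_iff)
  then show ?thesis using excess_pos[of k] by (simp add: long_ratio_def)
qed

lemma long_ratio_Suc:
  "(long_ratio (Suc k))\<^sup>2 - long_ratio (Suc k) = rho * (1 - 1 / long_ratio k)"
proof -
  define u v where "u = long_ratio k" and "v = long_ratio (Suc k)"
  have u: "1 < u" "0 < u\<^sup>2 - u" and v: "0 < v\<^sup>2 - v"
    using long_ratio_gt_1[of k] long_ratio_gt_1[of "Suc k"]
    by (simp_all add: u_def v_def power2_eq_square)
  have "2 / (v\<^sup>2 - v) * (rho * rho ^ k) = u\<^sup>2 * (2 / (u\<^sup>2 - u) * rho ^ k)"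
    using r_Suc_prod[of k] r_long_ratio[of k] r_long_ratio[of "Suc k"]
    unfolding u_def v_def long_ratio_def[of k, symmetric] by simp
  then have "2 / (v\<^sup>2 - v) * rho * rho ^ k = u\<^sup>2 * (2 / (u\<^sup>2 - u)) * rho ^ k" by simp
  then have "2 / (v\<^sup>2 - v) * rho = u\<^sup>2 * (2 / (u\<^sup>2 - u))"
    by (rule mult_right_cancel[THEN iffD1, rotated]) (use rho_gt_1 in simp)
  then have "rho * (u\<^sup>2 - u) = u\<^sup>2 * (v\<^sup>2 - v)" using u v by (simp add: field_simps)
  then have "v\<^sup>2 - v = rho * (u\<^sup>2 - u) / u\<^sup>2" using u by (simp add: field_simps)
  also have "\<dots> = rho * (1 - 1 / u)" using u by (simp add: field_simps power2_eq_square)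
  finally show ?thesis by (simp add: u_def v_def)
qed

text \<open>With \<open>s = sqrt rho\<close>, the recursion factors as \<open>(v - s) * (v + s - 1) * u = s * (u - s)\<close>. Above
  the fixed point \<open>u \<ge> s\<close> and \<open>v \<ge> s\<close>, hence the error is divided by at least \<open>2 * s - 1\<close>,
  and \<open>5 / 4 \<le> s\<close> makes this at least \<open>3 / 2\<close>.\<close>

lemma long_ratio_contraction:
  assumes "sqrt rho \<le> long_ratio k"
  shows "sqrt rho \<le> long_ratio (Suc k)"
    and "long_ratio (Suc k) - sqrt rho \<le> (2 / 3) * (long_ratio k - sqrt rho)"
proof -
  define s u v where "s = sqrt rho" and "u = long_ratio k" and "v = long_ratio (Suc k)"
  have "1 \<le> sqrt (2::real)" by simp
  then have "sqrt (25 / 16) \<le> s"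
    unfolding s_def rho_def by (intro real_sqrt_le_mono) linarith
  then have s: "5 / 4 \<le> s" "rho = s\<^sup>2"
    using rho_gt_1 by (simp_all add: s_def real_sqrt_divide)
  have u: "s \<le> u" and v: "1 < v"
    using assms long_ratio_gt_1 by (simp_all add: s_def u_def v_def)
  have "v\<^sup>2 - v = s\<^sup>2 * (1 - 1 / u)"
    using long_ratio_Suc[of k] s by (simp add: u_def v_def)
  then have eq: "(v - s) * (v + s - 1) * u = s * (u - s)"
    using u s(1) by (simp add: field_simps power2_eq_square)
  have "0 \<le> (v - s) * ((v + s - 1) * u)"
    using eq u s(1) by (simp add: mult.assoc)
  moreover have "0 < (v + s - 1) * u" using u v s(1) by simp
  ultimately have vs: "s \<le> v" by (simp add: zero_le_mult_iff)
  have "(3 / 2) * s \<le> (v + s - 1) * u"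
    using vs u s(1) by (intro mult_mono) auto
  then have "(v - s) * ((3 / 2) * s) \<le> s * (u - s)"
    using vs eq by (metis mult.assoc mult_left_mono diff_ge_0_iff_ge)
  then have "s * ((v - s) * (3 / 2)) \<le> s * (u - s)" by (simp add: algebra_simps)
  then have "(v - s) * (3 / 2) \<le> u - s" using s(1) by simp
  with vs show "sqrt rho \<le> long_ratio (Suc k)"
    and "long_ratio (Suc k) - sqrt rho \<le> (2 / 3) * (long_ratio k - sqrt rho)"
    by (simp_all add: s_def u_def v_def)
qed

lemma long_ratio_limit: "long_ratio \<longlonglongrightarrow> sqrt rho"
proof -
  \<comment> \<open>The initial value is \<open>1 / (3 / 2 - 1) = 2\<close>, above the fixed point, so the contraction
    applies from the start.\<close>
  have "sqrt rho \<le> long_ratio k \<and> long_ratio k - sqrt rho \<le> (2 / 3) ^ k * (2 - sqrt rho)" for k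
  proof (induction k)
    case 0
    have "rho \<le> 2\<^sup>2" using sqrt2_less_2 by (simp add: rho_def)
    then have "sqrt rho \<le> 2" by (intro real_le_lsqrt) auto
    then show ?case by (simp add: long_ratio_def excess_def)
  next
    case (Suc k)
    with long_ratio_contraction[of k] show ?case by simp
  qed
  then have "\<bar>long_ratio k - sqrt rho\<bar> \<le> (2 / 3) ^ k * (2 - sqrt rho)" for k
    by simp
  moreover have "(\<lambda>k. (2 / 3) ^ k * (2 - sqrt rho)) \<longlonglongrightarrow> 0 * (2 - sqrt rho)"
    by (intro tendsto_intros LIMSEQ_power_zero) simp
  ultimately have "(\<lambda>k. long_ratio k - sqrt rho) \<longlonglongrightarrow> 0"
    by - (rule Lim_null_comparison[OF always_eventually], simp_all)
  then show ?thesis by (simp add: LIM_zero_iff)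
qed

text \<open>As \<open>2 powr log 2 rho = rho\<close>, the denominator is \<open>rho ^ (j + 1)\<close> up to a factor that tends to
  1. The constant becomes \<open>2 / (rho - sqrt rho) / rho\<close>, which is the stated one since
  \<open>(rho - 1)\<^sup>2 = 2\<close>.\<close>

lemma r_asymptotics:
  "(\<lambda>j. r j / real (2 ^ (j + 1) - 2) powr log 2 rho)
     \<longlonglongrightarrow> (rho - 1) * (1 + rho powr (-1/2)) / rho"
proof -
  have sq: "1 < sqrt rho" "(sqrt rho)\<^sup>2 = rho" using rho_gt_1 by simp_all
  have lt: "sqrt rho < rho"
  proof -
    have "sqrt rho * 1 < sqrt rho * sqrt rho"
      by (rule mult_strict_left_mono) (use sq in auto)
    then show ?thesis using sq(2) by (simp add: power2_eq_square)
  qed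
  have pow: "real (2 ^ (j + 1) - 2) powr log 2 rho = (1 - (1 / 2) ^ j) powr log 2 rho * rho * rho ^ j" for j
  proof -
    have "(2::nat) \<le> 2 ^ (j + 1)" by (simp add: one_le_power)
    then have "real (2 ^ (j + 1) - 2) = (1 - (1 / 2) ^ j) * 2 ^ (j + 1)"
      by (simp add: of_nat_diff power_divide field_simps)
    moreover have "(2 ^ (j + 1) :: real) powr log 2 rho = rho ^ (j + 1)"
    proof -
      have pow2: "(2::real) ^ (j + 1) = 2 powr real (j + 1)"
        by (rule powr_realpow[symmetric]) simp
      have "(2 ^ (j + 1) :: real) powr log 2 rho = (2 powr log 2 rho) powr real (j + 1)"
        unfolding pow2 by (simp only: powr_powr mult.commute)
      also have "\<dots> = rho ^ (j + 1)"
        using rho_gt_1 by (subst powr_realpow) auto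
      finally show ?thesis .
    qed
    ultimately show ?thesis
      by (simp add: powr_mult power_le_one)
  qed
  have 1: "(\<lambda>j. (2 / ((long_ratio j)\<^sup>2 - long_ratio j)) / ((1 - (1 / 2) ^ j) powr log 2 rho * rho))
      \<longlonglongrightarrow> (2 / ((sqrt rho)\<^sup>2 - sqrt rho)) / ((1 - 0) powr log 2 rho * rho)"
    using sq rho_gt_1
    by (intro tendsto_intros long_ratio_limit LIMSEQ_power_zero) (use lt in auto)
  have 2: "r j / real (2 ^ (j + 1) - 2) powr log 2 rho
      = (2 / ((long_ratio j)\<^sup>2 - long_ratio j)) / ((1 - (1 / 2) ^ j) powr log 2 rho * rho)" for j
    unfolding pow r_long_ratio using rho_gt_1 by simp
  have "2 / (rho - sqrt rho) = (rho - 1) * (1 + rho powr (-1/2))"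
  proof -
    have "rho powr (-1/2) = 1 / sqrt rho"
    proof -
      have "rho powr (-1/2) = rho powr (- (1/2))" by simp
      also have "\<dots> = 1 / rho powr (1/2)" by (rule powr_minus_divide)
      also have "\<dots> = 1 / sqrt rho" using rho_gt_1 by (simp add: powr_half_sqrt)
      finally show ?thesis .
    qed
    moreover have "(rho - 1) * (rho - 1) = 2" by (simp add: rho_def)
    moreover have "(1 + 1 / sqrt rho) * (rho - sqrt rho) = rho - 1"
    proof -
      have "rho / sqrt rho = sqrt rho" using rho_gt_1 by (intro real_div_sqrt) simp
      then show ?thesis using sq(1) by (simp add: distrib_right diff_divide_distrib)
    qed
    ultimately have "(rho - 1) * (1 + rho powr (-1/2)) * (rho - sqrt rho) = 2"
      by (simp only: mult.assoc)
    moreover have "rho - sqrt rho \<noteq> 0" using lt by simp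
    ultimately show ?thesis by (simp add: divide_eq_eq)
  qed
  then show ?thesis using 1 sq(2) unfolding 2 by simp
qed

section \<open>Convex functions with Lipschitz gradient\<close>

lemma has_real_derivative_along_line:
  assumes "GDERIV f (x + t *\<^sub>R d) :> g"
  shows "((\<lambda>s. f (x + s *\<^sub>R d)) has_real_derivative (g \<bullet> d)) (at t)"
proof (rule has_derivative_imp_has_field_derivative)
  show "((\<lambda>s. f (x + s *\<^sub>R d)) has_derivative (\<lambda>h. (h *\<^sub>R d) \<bullet> g)) (at t)"
    using assms unfolding gderiv_def
    by (rule has_derivative_compose[where g = f, rotated]) (auto intro!: derivative_eq_intros)
  show "h * (g \<bullet> d) = (h *\<^sub>R d) \<bullet> g" for h
    by (simp add: inner_commute)
qed

lemma tangent_below: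
  fixes f :: "'a::euclidean_space \<Rightarrow> real"
  assumes conv: "convex_on UNIV f" and g: "GDERIV f x :> g"
  shows "g \<bullet> (y - x) \<le> f y - f x"
proof -
  define \<psi> where "\<psi> t = f (x + t *\<^sub>R (y - x))" for t :: real
  have "convex_on UNIV \<psi>"
  proof (rule convex_onI)
    fix t a b :: real assume t: "0 < t" "t < 1"
    have "x + ((1 - t) *\<^sub>R a + t *\<^sub>R b) *\<^sub>R (y - x)
        = (1 - t) *\<^sub>R (x + a *\<^sub>R (y - x)) + t *\<^sub>R (x + b *\<^sub>R (y - x))"
      by (simp add: algebra_simps)
    then show "\<psi> ((1 - t) *\<^sub>R a + t *\<^sub>R b) \<le> (1 - t) * \<psi> a + t * \<psi> b"
      unfolding \<psi>_def using convex_onD[OF conv, of t] t by simp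
  qed simp
  moreover have "(\<psi> has_real_derivative (g \<bullet> (y - x))) (at 0 within UNIV)"
    unfolding \<psi>_def using g by (intro has_real_derivative_along_line) simp
  ultimately have "(g \<bullet> (y - x)) * (1 - 0) \<le> \<psi> 1 - \<psi> 0"
    by (intro convex_on_imp_above_tangent[where A = UNIV]) auto
  then show ?thesis by (simp add: \<psi>_def)
qed

text \<open>Along the segment from \<open>x\<close> to \<open>x + d\<close>, the difference of the two sides decreases, as the
  Lipschitz bound for the gradient makes its derivative nonpositive.\<close>

lemma descent_lemma:
  fixes f :: "'a::euclidean_space \<Rightarrow> real"
  assumes "L_smooth L f"
  shows "f (x + d) \<le> f x + grad f x \<bullet> d + L * (norm d)\<^sup>2 / 2"
proof -
  define \<psi> where "\<psi> t = f (x + t *\<^sub>R d) - t * (grad f x \<bullet> d) - L * t\<^sup>2 * (norm d)\<^sup>2 / 2" for t :: real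
  define \<psi>' where "\<psi>' t = (grad f (x + t *\<^sub>R d) - grad f x) \<bullet> d - L * t * (norm d)\<^sup>2" for t :: real
  have der: "(\<psi> has_real_derivative \<psi>' t) (at t)" for t
    unfolding \<psi>_def \<psi>'_def
    by (auto intro!: derivative_eq_intros has_real_derivative_along_line L_smooth_GDERIV[OF assms]
        simp: inner_diff_left)
  have "\<psi>' t \<le> 0" if "0 \<le> t" for t
  proof -
    have "norm (grad f (x + t *\<^sub>R d) - grad f x) \<le> L * (t * norm d)"
      using assms lipschitz_onD[of L UNIV "grad f" "x + t *\<^sub>R d" x] that
      by (simp add: L_smooth_def dist_norm)
    then have "norm (grad f (x + t *\<^sub>R d) - grad f x) * norm d \<le> L * (t * norm d) * norm d"
      by (rule mult_right_mono) simp
    with norm_cauchy_schwarz[of "grad f (x + t *\<^sub>R d) - grad f x" d]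
    show ?thesis unfolding \<psi>'_def by (simp add: power2_eq_square algebra_simps)
  qed
  then have "\<psi> 1 \<le> \<psi> 0"
    using der by (intro DERIV_nonpos_imp_nonincreasing[of 0 1 \<psi>]) auto
  then show ?thesis by (simp add: \<psi>_def)
qed

text \<open>Compare the values at the auxiliary point \<open>w\<close>, reached from \<open>x\<close> by a gradient step of length
  \<open>1 / L\<close> for the function \<open>f\<close> minus its linear part at \<open>y\<close>: the tangent at \<open>y\<close> bounds \<open>f w\<close> from
  below, the descent lemma at \<open>x\<close> from above.\<close>

lemma smooth_convex_interpolation:
  fixes f :: "'a::euclidean_space \<Rightarrow> real"
  assumes L: "0 < L" and conv: "convex_on UNIV f" and smooth: "L_smooth L f"
  shows "grad f y \<bullet> (x - y) + (norm (grad f x - grad f y))\<^sup>2 / (2 * L) \<le> f x - f y"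
proof -
  define \<delta> where "\<delta> = grad f x - grad f y"
  define w where "w = x - (1 / L) *\<^sub>R \<delta>"
  have "grad f y \<bullet> (w - y) \<le> f w - f y"
    by (rule tangent_below[OF conv L_smooth_GDERIV[OF smooth]])
  moreover have "L * (norm (- ((1 / L) *\<^sub>R \<delta>)))\<^sup>2 / 2 = (\<delta> \<bullet> \<delta>) / (2 * L)"
    using L by (simp add: dot_square_norm power2_eq_square)
  then have "f w \<le> f x - (grad f x \<bullet> \<delta>) / L + (\<delta> \<bullet> \<delta>) / (2 * L)"
    using descent_lemma[OF smooth, of x "- ((1 / L) *\<^sub>R \<delta>)"] L
    by (simp add: w_def)
  moreover have "grad f y \<bullet> (w - y) = grad f y \<bullet> (x - y) - (grad f y \<bullet> \<delta>) / L"
    by (simp add: w_def algebra_simps)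
  moreover have "(grad f x \<bullet> \<delta>) / L - (grad f y \<bullet> \<delta>) / L = (\<delta> \<bullet> \<delta>) / L"
    by (simp add: \<delta>_def inner_diff_left diff_divide_distrib)
  moreover have "(\<delta> \<bullet> \<delta>) / L = (\<delta> \<bullet> \<delta>) / (2 * L) + (\<delta> \<bullet> \<delta>) / (2 * L)" by simp
  ultimately show ?thesis
    unfolding \<delta>_def[symmetric] power2_norm_eq_inner by linarith
qed

lemma interpolable_rescaled_gradient:
  fixes f :: "'a::euclidean_space \<Rightarrow> real"
  assumes L: "0 < L" and conv: "convex_on UNIV f" and smooth: "L_smooth L f"
  shows "interpolable (\<lambda>x. f x / L) (\<lambda>x. (1 / L) *\<^sub>R grad f x)"
proof
  fix x y
  have "(norm ((1 / L) *\<^sub>R grad f x - (1 / L) *\<^sub>R grad f y))\<^sup>2 = (norm (grad f x - grad f y))\<^sup>2 / L\<^sup>2"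
    unfolding scaleR_diff_right[symmetric] by (simp add: power_divide)
  moreover have "(grad f y \<bullet> (x - y) + (norm (grad f x - grad f y))\<^sup>2 / (2 * L)) / L \<le> (f x - f y) / L"
    using smooth_convex_interpolation[OF assms] L by (intro divide_right_mono) auto
  ultimately show "((1 / L) *\<^sub>R grad f y) \<bullet> (x - y)
      + (norm ((1 / L) *\<^sub>R grad f x - (1 / L) *\<^sub>R grad f y))\<^sup>2 / 2 \<le> f x / L - f y / L"
    by (simp add: add_divide_distrib diff_divide_distrib power2_eq_square mult.assoc)
qed

lemma grad_minimizer:
  fixes f :: "'a::euclidean_space \<Rightarrow> real"
  assumes "L_smooth L f" "\<And>y. f z \<le> f y"
  shows "grad f z = 0"
proof -
  have "(f has_derivative (\<lambda>h. h \<bullet> grad f z)) (at z)"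
    using L_smooth_GDERIV[OF assms(1)] by (simp add: gderiv_def)
  then have "(\<lambda>h. h \<bullet> grad f z) = (\<lambda>h. 0)"
    using assms(2) by (intro has_derivative_local_min) auto
  then show ?thesis by (metis inner_eq_zero_iff)
qed

theorem theorem3:
  fixes L :: real and f :: "real ^ 'n \<Rightarrow> real" and xstar :: "real ^ 'n"
    and k N :: nat and h :: "real list" and x :: "nat \<Rightarrow> real ^ 'n"
  assumes "L > 0"
    and "convex_on UNIV f"
    and "L_smooth L f"
    and "\<And>y. f xstar \<le> f y"
    and "N = 2 ^ (k + 1) - 2"
    and "h = h_right k @ h_left k"
    and "\<And>i. i < N \<Longrightarrow> x (Suc i) = x i - (h ! i / L) *\<^sub>R grad f (x i)"
  shows "norm (grad f (x N)) \<le> L * norm (x 0 - xstar) / r k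
    \<and> (\<lambda>j. r j / real (2 ^ (j + 1) - 2) powr log 2 rho)
        \<longlonglongrightarrow> (rho - 1) * (1 + rho powr (-1/2)) / rho"
proof
  define \<gamma> where "\<gamma> = (\<lambda>x. (1 / L) *\<^sub>R grad f x)"
  interpret interpolable "\<lambda>x. f x / L" \<gamma>
    unfolding \<gamma>_def by (rule interpolable_rescaled_gradient[OF assms(1-3)])
  have N: "N = length h"
    using assms(5,6) by (simp add: h_left_def length_h_right)
  have "x N = gd \<gamma> (x 0) h"
    unfolding N by (rule gd_eqI) (use assms(7) N in \<open>simp add: \<gamma>_def\<close>)
  moreover have "\<gamma> xstar = 0"
    using grad_minimizer[OF assms(3,4)] by (simp add: \<gamma>_def)
  ultimately have "norm (\<gamma> (x N)) \<le> norm (x 0 - xstar) / r k"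
    using norm_gradient_bound assms(6) by simp
  then show "norm (grad f (x N)) \<le> L * norm (x 0 - xstar) / r k"
    using \<open>L > 0\<close> by (simp add: \<gamma>_def field_simps)
qed (rule r_asymptotics)

end
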